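(* Let $n\ge 0$ be an integer, let $Q_n$ be the $n$-dimensional hypercube graph with its natural edge coloring, and let $G$ be a connected subgraph of $Q_n$, edge-colored by the restriction of the coloring of $Q_n$. Then $G$ is a rainbow boomerang graph if and only if, for every subhypercube $Q_{n'}$ of $Q_n$, the intersection $G\cap Q_{n'}$ is connected.
   Context: An edge-colored graph is a graph $G=(V,E)$ (a priori loops and multiple edges are allowed) with a map $\phi:E\to C$ onto a set $C$ of colors. It is properly colored if for each vertex the incident edges have pairwise distinct colors. A walk of length $k\ge 0$ is a finite alternating sequence $v_0e_1v_1\dots e_kv_k$ of vertices and edges such that $e_i$ has ends $v_{i-1},v_i$. A walk is shortest if there is no shorter walk between the same pair of vertices; it is rainbow if its edge colors are pairwise distinct. A rainbow boomerang graph is a properly colored edge-colored graph in which a walk is shortest if and only if it is rainbow. The hypercube $Q_n$ has vertex set $(\mathbb Z/2\mathbb Z)^{\oplus n}$, with an edge between two vertices exactly when they differ in exactly one coordinate; the edge is colored by the index $i\in\{1,\dots,n\}$ of that coordinate. A subgraph consists of a subset of the vertices and a subset of the edges between them; when $G\subseteq Q_n$ is viewed as an edge-colored graph, its color set is the set of colors that occur on its edges. A subhypercube $Q_{n'}$ ($0\le n'\le n$) of $Q_n$ is the induced subgraph on the set of vertices obtained by prescribing the values of $n-n'$ of the coordinates. $G\cap Q_{n'}$ is the graph whose vertices and edges are those lying in both $G$ and $Q_{n'}$; the empty graph is regarded as connected. *)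

theory Defs
  imports "HOL-Library.FuncSet" "HOL-Library.Z2"
begin

text \<open>
  Graphs may have loops and multiple edges: an edge \<open>e\<close> is an abstract object whose set of ends
  \<open>ends G e\<close> has two elements, or one if \<open>e\<close> is a loop.  The fields \<open>ends\<close> and \<open>color\<close> are
  meaningful only on \<open>edges G\<close>.  The coloring is a map onto a set of colors, so that set is not
  a separate component: it is \<open>color G ` edges G\<close>.
\<close>

record ('v, 'e, 'c) ec_graph =
  verts :: "'v set"
  edges :: "'e set"
  ends :: "'e \<Rightarrow> 'v set"
  color :: "'e \<Rightarrow> 'c"

definition edge_colored_graph :: "('v, 'e, 'c) ec_graph \<Rightarrow> bool" where
  "edge_colored_graph G \<longleftrightarrow> (\<forall>e\<in>edges G. \<exists>u\<in>verts G. \<exists>v\<in>verts G. ends G e = {u, v})"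

definition properly_colored :: "('v, 'e, 'c) ec_graph \<Rightarrow> bool" where
  "properly_colored G \<longleftrightarrow>
     (\<forall>v\<in>verts G. inj_on (color G) {e \<in> edges G. v \<in> ends G e})"

text \<open>
  The walk \<open>v\<^sub>0 e\<^sub>1 v\<^sub>1 \<dots> e\<^sub>k v\<^sub>k\<close> is given by its vertices \<open>vs = [v\<^sub>0, \<dots>, v\<^sub>k]\<close> and its edges
  \<open>es = [e\<^sub>1, \<dots>, e\<^sub>k]\<close>, so its length
  is \<open>length es\<close>.
\<close>

definition walk :: "('v, 'e, 'c) ec_graph \<Rightarrow> 'v list \<Rightarrow> 'e list \<Rightarrow> bool" where
  "walk G vs es \<longleftrightarrow>
     length vs = Suc (length es) \<and> set vs \<subseteq> verts G \<and> set es \<subseteq> edges G \<and>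
     (\<forall>i<length es. ends G (es ! i) = {vs ! i, vs ! Suc i})"

definition shortest :: "('v, 'e, 'c) ec_graph \<Rightarrow> 'v list \<Rightarrow> 'e list \<Rightarrow> bool" where
  "shortest G vs es \<longleftrightarrow>
     (\<nexists>vs' es'. walk G vs' es' \<and> hd vs' = hd vs \<and> last vs' = last vs \<and>
        length es' < length es)"

definition rainbow :: "('v, 'e, 'c) ec_graph \<Rightarrow> 'e list \<Rightarrow> bool" where
  "rainbow G es \<longleftrightarrow> distinct (map (color G) es)"

definition rainbow_boomerang :: "('v, 'e, 'c) ec_graph \<Rightarrow> bool" where
  "rainbow_boomerang G \<longleftrightarrow>
     edge_colored_graph G \<and> properly_colored G \<and>
     (\<forall>vs es. walk G vs es \<longrightarrow> (shortest G vs es \<longleftrightarrow> rainbow G es))"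

text \<open>The empty graph counts as connected.\<close>

definition connected_graph :: "('v, 'e, 'c) ec_graph \<Rightarrow> bool" where
  "connected_graph G \<longleftrightarrow>
     (\<forall>u\<in>verts G. \<forall>v\<in>verts G. \<exists>vs es. walk G vs es \<and> hd vs = u \<and> last vs = v)"

definition subgraph :: "('v, 'e, 'c) ec_graph \<Rightarrow> ('v, 'e, 'c) ec_graph \<Rightarrow> bool" where
  "subgraph H G \<longleftrightarrow>
     edge_colored_graph H \<and> verts H \<subseteq> verts G \<and> edges H \<subseteq> edges G \<and>
     (\<forall>e\<in>edges H. ends H e = ends G e \<and> color H e = color G e)"

definition induced_subgraph :: "('v, 'e, 'c) ec_graph \<Rightarrow> 'v set \<Rightarrow> ('v, 'e, 'c) ec_graph" where
  "induced_subgraph G S =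
     \<lparr>verts = verts G \<inter> S, edges = {e \<in> edges G. ends G e \<subseteq> S}, ends = ends G, color = color G\<rparr>"

text \<open>
  Intended for two subgraphs of a common graph, so that \<open>G\<close> and \<open>H\<close> agree about the ends and
  colors of their common edges.
\<close>

definition graph_inter ::
  "('v, 'e, 'c) ec_graph \<Rightarrow> ('v, 'e, 'c) ec_graph \<Rightarrow> ('v, 'e, 'c) ec_graph" where
  "graph_inter G H =
     \<lparr>verts = verts G \<inter> verts H, edges = edges G \<inter> edges H, ends = ends G, color = color G\<rparr>"

text \<open>
  Elements of \<open>(\<int>/2\<int>)\<^sup>n\<close> are functions to the two-element field \<open>bit\<close>, extensional outside
  \<open>{1..n}\<close>.  The hypercube is simple, so an edge is its own set of ends.
\<close>

type_synonym cube_graph = "(nat \<Rightarrow> bit, (nat \<Rightarrow> bit) set, nat) ec_graph"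

definition cube_verts :: "nat \<Rightarrow> (nat \<Rightarrow> bit) set" where
  "cube_verts n = ({1..n} \<rightarrow>\<^sub>E UNIV)"

definition hypercube :: "nat \<Rightarrow> cube_graph" where
  "hypercube n =
     \<lparr>verts = cube_verts n,
      edges = {{x, y} | x y. x \<in> cube_verts n \<and> y \<in> cube_verts n \<and> (\<exists>!i. i \<in> {1..n} \<and> x i \<noteq> y i)},
      ends = (\<lambda>e. e),
      color = (\<lambda>e. THE i. i \<in> {1..n} \<and> (\<exists>x\<in>e. \<exists>y\<in>e. x i \<noteq> y i))\<rparr>"

definition subhypercube :: "nat \<Rightarrow> nat \<Rightarrow> cube_graph \<Rightarrow> bool" where
  "subhypercube n' n H \<longleftrightarrow>
     n' \<le> n \<and>
     (\<exists>I a. I \<subseteq> {1..n} \<and> card I = n - n' \<and>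
        H = induced_subgraph (hypercube n) {x \<in> cube_verts n. \<forall>i\<in>I. x i = a i})"

end

theory Submission
  imports Defs
begin

text \<open>
  A walk in a subgraph \<open>G\<close> of the hypercube flips one coordinate per edge, namely the color of the
  edge.  So its two ends can only differ in coordinates that occur among its colors, and when the
  walk is rainbow they differ in exactly these (\<open>differ_walk_subset\<close>, \<open>differ_rainbow_walk\<close>).
  Hence every walk is at least as long as the Hamming distance of its ends, and it has that length
  if and only if it is rainbow.  In particular rainbow walks are always shortest, and \<open>G\<close> is a
  rainbow boomerang graph as soon as every two vertices are joined in \<open>G\<close> by a walk as long as their
  Hamming distance.

  Suppose that all intersections with subhypercubes are connected, and let \<open>u \<noteq> v\<close> be vertices
  of \<open>G\<close>.  In the smallest subhypercube that contains both, some walk in \<open>G\<close> leads from \<open>u\<close> to \<open>v\<close>.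
  Its first edge flips a coordinate in which \<open>u\<close> and \<open>v\<close> differ, since the others are
  constant there.  Thus one step inside \<open>G\<close> decreases the Hamming distance to \<open>v\<close>, and induction on
  that distance gives a walk of the required length (\<open>hamming_walk_exists\<close>).

  Conversely, in a rainbow boomerang graph a shortest walk between two vertices of a subhypercube
  is rainbow, so it only flips coordinates in which its ends differ.  The prescribed coordinates
  are not among them, and the walk stays in the subhypercube
  (\<open>intersection_connected_if_rainbow_boomerang\<close>).
\<close>

section \<open>Walks\<close>

lemma walk_Nil_iff: "walk G vs [] \<longleftrightarrow> (\<exists>v\<in>verts G. vs = [v])"
  by (auto simp: walk_def length_Suc_conv)

lemma walk_Cons_iff:
  "walk G vs (e # es) \<longleftrightarrow>
     (\<exists>u w ws. vs = u # w # ws \<and> u \<in> verts G \<and> e \<in> edges G \<and> ends G e = {u, w} \<and>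
        walk G (w # ws) es)"
proof
  assume *: "walk G vs (e # es)"
  then obtain u w ws where vs: "vs = u # w # ws"
    by (auto simp: walk_def length_Suc_conv)
  have ends: "ends G ((e # es) ! i) = {vs ! i, vs ! Suc i}" if "i < Suc (length es)" for i
    using * that by (simp add: walk_def)
  have "ends G e = {u, w}"
    using ends[of 0] vs by simp
  moreover have "ends G (es ! i) = {(w # ws) ! i, (w # ws) ! Suc i}" if "i < length es" for i
    using ends[of "Suc i"] that vs by simp
  ultimately show "\<exists>u w ws. vs = u # w # ws \<and> u \<in> verts G \<and> e \<in> edges G \<and> ends G e = {u, w} \<and>
        walk G (w # ws) es"
    using * vs by (auto simp: walk_def)
qed (auto simp: walk_def nth_Cons split: nat.splits)

lemma walk_induct [consumes 1, case_names Nil Cons]: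
  assumes "walk G vs es"
    and "\<And>v. v \<in> verts G \<Longrightarrow> P [v] []"
    and "\<And>u w ws e es. u \<in> verts G \<Longrightarrow> e \<in> edges G \<Longrightarrow> ends G e = {u, w} \<Longrightarrow>
           walk G (w # ws) es \<Longrightarrow> P (w # ws) es \<Longrightarrow> P (u # w # ws) (e # es)"
  shows "P vs es"
  using assms(1)
proof (induction es arbitrary: vs)
  case Nil
  then show ?case
    using assms(2) by (auto simp: walk_Nil_iff)
next
  case (Cons e es)
  then show ?case
    using assms(3) by (auto simp: walk_Cons_iff)
qed

lemma walk_graph_inter_iff:
  "walk (graph_inter G H) vs es \<longleftrightarrow> walk G vs es \<and> set vs \<subseteq> verts H \<and> set es \<subseteq> edges H"
  by (auto simp: walk_def graph_inter_def)

lemma hd_last_in_verts: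
  assumes "walk G vs es"
  shows "hd vs \<in> verts G" "last vs \<in> verts G"
  using assms by (induction rule: walk_induct) auto

lemma shortest_walk_exists:
  assumes "walk G vs es"
  obtains vs' es' where "walk G vs' es'" "hd vs' = hd vs" "last vs' = last vs" "shortest G vs' es'"
proof -
  let ?W = "\<lambda>(vs', es'). walk G vs' es' \<and> hd vs' = hd vs \<and> last vs' = last vs"
  obtain p where "?W p" and least: "\<And>q. ?W q \<Longrightarrow> length (snd p) \<le> length (snd q)"
    using ex_has_least_nat[of ?W "(vs, es)" "length \<circ> snd"] assms by auto
  moreover obtain vs' es' where "p = (vs', es')"
    by fastforce
  ultimately show thesis
    using that[of vs' es'] by (fastforce simp: shortest_def not_less)
qed

section \<open>Differing coordinates\<close>

text \<open>The Hamming distance of \<open>x\<close> and \<open>y\<close> is the cardinality of this set.\<close>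

definition differ :: "('i \<Rightarrow> bit) \<Rightarrow> ('i \<Rightarrow> bit) \<Rightarrow> 'i set" where
  "differ x y = {i. x i \<noteq> y i}"

lemma differ_empty_iff: "differ x y = {} \<longleftrightarrow> x = y"
  by (auto simp: differ_def)

lemma differ_commute: "differ x y = differ y x"
  by (auto simp: differ_def)

lemma differ_triangle: "differ x z \<subseteq> differ x y \<union> differ y z"
  by (auto simp: differ_def)

text \<open>
  A coordinate takes only two values, so it is the same in \<open>x\<close> and \<open>z\<close> if it changes both from \<open>x\<close>
  to \<open>y\<close> and from \<open>y\<close> to \<open>z\<close>.
\<close>

lemma differ_symmetric_difference:
  "differ x z = (differ x y - differ y z) \<union> (differ y z - differ x y)"
  unfolding differ_def by auto (metis bit.exhaust)

lemma differ_cancel_left: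
  assumes "differ x y = differ x z"
  shows "y = z"
  using differ_symmetric_difference[of y z x] assms differ_commute[of y x] differ_empty_iff
  by fastforce

lemma differ_cube_verts:
  assumes "x \<in> cube_verts n" "y \<in> cube_verts n"
  shows "differ x y \<subseteq> {1..n}"
proof -
  have "x i = y i" if "i \<notin> {1..n}" for i
    using assms that unfolding cube_verts_def by (metis PiE_arb)
  then show ?thesis
    unfolding differ_def by blast
qed

section \<open>Walks in subgraphs of the hypercube\<close>

context
  fixes n :: nat and G :: cube_graph
  assumes sub: "subgraph G (hypercube n)"
begin

lemma verts_subset_cube: "verts G \<subseteq> cube_verts n"
  using sub by (simp add: subgraph_def hypercube_def)

lemma finite_differ:
  assumes "x \<in> verts G" "y \<in> verts G"
  shows "finite (differ x y)"
  using assms verts_subset_cube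
  by (intro finite_subset[OF differ_cube_verts[of x n y]]) auto

lemma differ_edge:
  assumes e: "e \<in> edges G" and xy: "ends G e = {x, y}"
  shows "differ x y = {color G e}"
proof -
  have cube: "e \<in> edges (hypercube n)" "ends G e = ends (hypercube n) e"
    "color G e = color (hypercube n) e"
    using sub e unfolding subgraph_def by blast+
  then have eq: "e = {x, y}"
    and col: "color G e = (THE i. i \<in> {1..n} \<and> (\<exists>x\<in>e. \<exists>y\<in>e. x i \<noteq> y i))"
    using xy by (simp_all add: hypercube_def)
  from cube(1) obtain p q where pq: "e = {p, q}" "p \<in> cube_verts n" "q \<in> cube_verts n"
    and ex1: "\<exists>!i. i \<in> {1..n} \<and> p i \<noteq> q i"
    unfolding hypercube_def ec_graph.simps mem_Collect_eq by metis
  from ex1 obtain i where i: "i \<in> {1..n}" "p i \<noteq> q i"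
    and uniq: "\<And>j. j \<in> {1..n} \<Longrightarrow> p j \<noteq> q j \<Longrightarrow> j = i"
    by blast
  have pq_i: "differ p q = {i}"
  proof
    show "differ p q \<subseteq> {i}"
      using uniq differ_cube_verts[OF pq(2,3)] unfolding differ_def by blast
  qed (simp add: differ_def i(2))
  moreover have "differ x y = differ p q"
    using eq pq(1) differ_commute by (metis doubleton_eq_iff)
  moreover have "(THE i. i \<in> {1..n} \<and> (\<exists>x\<in>{p, q}. \<exists>y\<in>{p, q}. x i \<noteq> y i)) = i"
  proof (rule the_equality)
    show "i \<in> {1..n} \<and> (\<exists>x\<in>{p, q}. \<exists>y\<in>{p, q}. x i \<noteq> y i)"
      using i by blast
  next
    fix j
    assume "j \<in> {1..n} \<and> (\<exists>x\<in>{p, q}. \<exists>y\<in>{p, q}. x j \<noteq> y j)"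
    then have "p j \<noteq> q j"
      by (metis empty_iff insert_iff)
    then show "j = i"
      using pq_i by (auto simp: differ_def)
  qed
  ultimately show ?thesis
    using col pq(1) by simp
qed

text \<open>
  Flipping a given coordinate of \<open>v\<close> leads to only one vertex, so the color of an edge at \<open>v\<close>
  determines its other end.
\<close>

lemma properly_colored: "properly_colored G"
  unfolding properly_colored_def
proof (intro ballI inj_onI)
  fix v e f
  assume e: "e \<in> {e \<in> edges G. v \<in> ends G e}" and f: "f \<in> {e \<in> edges G. v \<in> ends G e}"
    and col: "color G e = color G f"
  have other_end: "\<exists>w. ends G g = {v, w}" if "g \<in> edges G" "v \<in> ends G g" for g
  proof -
    have "\<exists>p q. ends G g = {p, q}"
      using sub that(1) by (meson edge_colored_graph_def subgraph_def)
    then show ?thesis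
      using that(2) by auto
  qed
  obtain x y where x: "ends G e = {v, x}" and y: "ends G f = {v, y}"
    using other_end[of e] other_end[of f] e f by auto
  have "differ v x = differ v y"
    using differ_edge[OF _ x] differ_edge[OF _ y] e f col by simp
  then have "ends G e = ends G f"
    using differ_cancel_left x y by metis
  then show "e = f"
    using sub e f by (simp add: subgraph_def hypercube_def)
qed

text \<open>
  Besides the last vertex, the inner vertices are controlled as well: this is what keeps a rainbow
  walk inside a subhypercube that contains both of its ends.
\<close>

lemma differ_walk_vertex_subset:
  assumes "walk G vs es" "x \<in> set vs"
  shows "differ (hd vs) x \<subseteq> color G ` set es"
  using assms
proof (induction rule: walk_induct)
  case (Nil v)
  then show ?case
    by (simp add: differ_def)
next
  case (Cons u w ws e es)
  show ?case
  proof (cases "x = u")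
    case True
    then show ?thesis
      by (simp add: differ_def)
  next
    case False
    then have "differ w x \<subseteq> color G ` set es"
      using Cons.IH Cons.prems by simp
    then show ?thesis
      using differ_triangle[of u x w] differ_edge[OF Cons.hyps(2,3)] by auto
  qed
qed

lemma differ_walk_subset:
  assumes "walk G vs es"
  shows "differ (hd vs) (last vs) \<subseteq> color G ` set es"
proof -
  have "vs \<noteq> []"
    using assms by (auto simp: walk_def)
  then show ?thesis
    using differ_walk_vertex_subset[OF assms] by simp
qed

text \<open>A coordinate that is flipped exactly once by a walk is not restored later.\<close>

lemma differ_rainbow_walk:
  assumes "walk G vs es" "rainbow G es"
  shows "differ (hd vs) (last vs) = color G ` set es"
  using assms
proof (induction rule: walk_induct)
  case (Nil v)
  then show ?case
    by (simp add: differ_def)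
next
  case (Cons u w ws e es)
  then have "differ w (last (w # ws)) = color G ` set es" "color G e \<notin> color G ` set es"
    by (auto simp: rainbow_def)
  then show ?case
    using differ_symmetric_difference[of u "last (w # ws)" w] differ_edge[OF Cons.hyps(2,3)]
    by auto
qed

lemma hamming_le_length:
  assumes "walk G vs es"
  shows "card (differ (hd vs) (last vs)) \<le> length es"
  using card_mono[OF _ differ_walk_subset[OF assms]] card_length[of "map (color G) es"] by simp

lemma rainbow_iff_length_eq_hamming:
  assumes "walk G vs es"
  shows "rainbow G es \<longleftrightarrow> length es = card (differ (hd vs) (last vs))"
proof
  assume "rainbow G es"
  then show "length es = card (differ (hd vs) (last vs))"
    using differ_rainbow_walk[OF assms] distinct_card[of "map (color G) es"]
    by (simp add: rainbow_def)
next
  assume "length es = card (differ (hd vs) (last vs))"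
  then have "length (map (color G) es) \<le> card (set (map (color G) es))"
    using card_mono[OF _ differ_walk_subset[OF assms]] by simp
  then show "rainbow G es"
    unfolding rainbow_def using card_distinct card_length le_antisym by blast
qed

lemma rainbow_imp_shortest:
  assumes "walk G vs es" "rainbow G es"
  shows "shortest G vs es"
proof -
  have "length es = card (differ (hd vs) (last vs))"
    using assms rainbow_iff_length_eq_hamming by simp
  then show ?thesis
    using hamming_le_length by (fastforce simp: shortest_def not_less)
qed

section \<open>Intersections with subhypercubes\<close>

text \<open>
  The subhypercube to use is the smallest one containing \<open>u\<close> and \<open>v\<close>: it prescribes all the
  coordinates in which they agree.
\<close>

lemma step_decreases_differ:
  assumes conn: "\<forall>n' H. subhypercube n' n H \<longrightarrow> connected_graph (graph_inter G H)"
    and u: "u \<in> verts G" and v: "v \<in> verts G" and "u \<noteq> v"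
  obtains e w where "e \<in> edges G" "ends G e = {u, w}" "w \<in> verts G"
    "card (differ u v) = Suc (card (differ w v))"
proof -
  define I where "I = {1..n} - differ u v"
  define S where "S = {x \<in> cube_verts n. \<forall>i\<in>I. x i = u i}"
  define H where "H = induced_subgraph (hypercube n) S"
  have "card I \<le> n"
    using card_mono[of "{1..n}" I] by (auto simp: I_def)
  then have "subhypercube (n - card I) n H"
    unfolding subhypercube_def H_def S_def
    by (intro conjI exI[of _ I] exI[of _ u]) (auto simp: I_def)
  then have "connected_graph (graph_inter G H)"
    using conn by blast
  moreover have "u \<in> S" "v \<in> S"
    using u v verts_subset_cube by (auto simp: S_def I_def differ_def)
  ultimately obtain vs es where "walk (graph_inter G H) vs es" and hl: "hd vs = u" "last vs = v"
    using u v verts_subset_cube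
    by (fastforce simp: connected_graph_def graph_inter_def H_def induced_subgraph_def
        hypercube_def)
  then have walk: "walk G vs es" "set vs \<subseteq> S"
    by (auto simp: walk_graph_inter_iff H_def induced_subgraph_def)
  have "es \<noteq> []"
    using walk hl \<open>u \<noteq> v\<close> by (auto simp: walk_Nil_iff)
  then obtain e es' w ws where vs: "vs = u # w # ws" and e: "e \<in> edges G" "ends G e = {u, w}"
    and rest: "walk G (w # ws) es'"
    using walk(1) hl(1) by (cases es) (auto simp: walk_Cons_iff)
  have w: "w \<in> verts G" "w \<in> S"
    using hd_last_in_verts(1)[OF rest] walk(2) vs by auto
  have uw: "differ u w = {color G e}"
    by (rule differ_edge[OF e])
  have "differ u w \<subseteq> differ u v"
    using differ_cube_verts[of u n w] w(2) u verts_subset_cube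
    by (fastforce simp: S_def I_def differ_def)
  then have "differ w v = differ u v - {color G e}" "color G e \<in> differ u v"
    using differ_symmetric_difference[of w v u] differ_commute[of w u] uw by auto
  then have "card (differ u v) = Suc (card (differ w v))"
    using card.remove[OF finite_differ[OF u v]] by simp
  then show thesis
    using that e w(1) by blast
qed

lemma hamming_walk_exists:
  assumes conn: "\<forall>n' H. subhypercube n' n H \<longrightarrow> connected_graph (graph_inter G H)"
    and "u \<in> verts G" and v: "v \<in> verts G"
  shows "\<exists>vs es. walk G vs es \<and> hd vs = u \<and> last vs = v \<and> length es = card (differ u v)"
  using \<open>u \<in> verts G\<close>
proof (induction "card (differ u v)" arbitrary: u rule: less_induct)
  case less
  show ?case
  proof (cases "u = v")
    case True
    then have "walk G [u] []"
      using v by (simp add: walk_Nil_iff)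
    then show ?thesis
      using True by (intro exI[of _ "[u]"] exI[of _ "[]"]) (simp add: differ_def)
  next
    case False
    obtain e w where e: "e \<in> edges G" "ends G e = {u, w}" and w: "w \<in> verts G"
      and card: "card (differ u v) = Suc (card (differ w v))"
      using step_decreases_differ[OF conn less.prems v False] by metis
    then obtain vs es where walk: "walk G vs es" and "hd vs = w" "last vs = v"
      "length es = card (differ w v)"
      using less.hyps[of w] by auto
    moreover obtain ws where vs: "vs = w # ws"
      using walk \<open>hd vs = w\<close> by (cases vs) (auto simp: walk_def)
    moreover have "walk G (u # vs) (e # es)"
      using walk vs e less.prems by (simp add: walk_Cons_iff)
    ultimately show ?thesis
      using card by (intro exI[of _ "u # vs"] exI[of _ "e # es"]) simp
  qed
qed

lemma rainbow_boomerang_if_intersections_connected: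
  assumes "\<forall>n' H. subhypercube n' n H \<longrightarrow> connected_graph (graph_inter G H)"
  shows "rainbow_boomerang G"
proof -
  have "rainbow G es" if walk: "walk G vs es" and short: "shortest G vs es" for vs es
  proof -
    obtain vs' es' where "walk G vs' es'" "hd vs' = hd vs" "last vs' = last vs"
      "length es' = card (differ (hd vs) (last vs))"
      using hamming_walk_exists[OF assms hd_last_in_verts[OF walk]] by metis
    then have "length es \<le> card (differ (hd vs) (last vs))"
      using short unfolding shortest_def by (metis not_less)
    then show ?thesis
      using hamming_le_length[OF walk] rainbow_iff_length_eq_hamming[OF walk] by simp
  qed
  moreover have "edge_colored_graph G"
    using sub by (simp add: subgraph_def)
  ultimately show ?thesis
    using properly_colored rainbow_imp_shortest by (auto simp: rainbow_boomerang_def)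
qed

lemma intersection_connected_if_rainbow_boomerang:
  assumes boom: "rainbow_boomerang G" and conn: "connected_graph G"
    and H: "subhypercube n' n H"
  shows "connected_graph (graph_inter G H)"
  unfolding connected_graph_def
proof (intro ballI)
  fix u v
  assume u: "u \<in> verts (graph_inter G H)" and v: "v \<in> verts (graph_inter G H)"
  obtain I a where H_eq: "H = induced_subgraph (hypercube n) {x \<in> cube_verts n. \<forall>i\<in>I. x i = a i}"
    using H by (auto simp: subhypercube_def)
  define S where "S = {x \<in> cube_verts n. \<forall>i\<in>I. x i = a i}"
  have uvS: "u \<in> S" "v \<in> S" and uvG: "u \<in> verts G" "v \<in> verts G"
    using u v by (auto simp: H_eq S_def graph_inter_def induced_subgraph_def)
  obtain vs es where walk: "walk G vs es" and hl: "hd vs = u" "last vs = v"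
    and "shortest G vs es"
    using conn uvG shortest_walk_exists[of G] unfolding connected_graph_def by metis
  then have "rainbow G es"
    using boom by (simp add: rainbow_boomerang_def)
  then have "color G ` set es = differ u v"
    using differ_rainbow_walk[OF walk] hl by simp
  then have between: "differ u x \<subseteq> differ u v" if "x \<in> set vs" for x
    using differ_walk_vertex_subset[OF walk that] hl by simp
  have "x \<in> S" if x: "x \<in> set vs" for x
  proof -
    have "x i = a i" if "i \<in> I" for i
    proof -
      have "u i = a i" "v i = a i"
        using uvS that by (simp_all add: S_def)
      then have "i \<notin> differ u v"
        by (simp add: differ_def)
      then have "i \<notin> differ u x"
        using between[OF x] by blast
      then show ?thesis
        using \<open>u i = a i\<close> by (simp add: differ_def)
    qed
    moreover have "x \<in> cube_verts n"
      using x walk verts_subset_cube by (auto simp: walk_def)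
    ultimately show ?thesis
      by (simp add: S_def)
  qed
  then have vsS: "set vs \<subseteq> S"
    by blast
  have "ends G e \<subseteq> S" if e: "e \<in> set es" for e
  proof -
    obtain i where "i < length es" "e = es ! i"
      using e by (metis in_set_conv_nth)
    then have "ends G e = {vs ! i, vs ! Suc i}" "vs ! i \<in> set vs" "vs ! Suc i \<in> set vs"
      using walk by (auto simp: walk_def)
    then show ?thesis
      using vsS by auto
  qed
  moreover have "e \<in> edges (hypercube n)" "ends (hypercube n) e = ends G e" if "e \<in> set es" for e
  proof -
    have "e \<in> edges G"
      using that walk by (auto simp: walk_def)
    then show "e \<in> edges (hypercube n)" "ends (hypercube n) e = ends G e"
      using sub by (auto simp: subgraph_def)
  qed
  ultimately have "set es \<subseteq> edges H"
    unfolding H_eq S_def[symmetric] by (simp add: induced_subgraph_def subset_iff)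
  moreover have "set vs \<subseteq> verts H"
    using vsS by (auto simp: H_eq S_def induced_subgraph_def hypercube_def)
  ultimately show "\<exists>vs es. walk (graph_inter G H) vs es \<and> hd vs = u \<and> last vs = v"
    using walk hl walk_graph_inter_iff by blast
qed

end

theorem theorem2p25:
  fixes n :: nat and G :: cube_graph
  assumes "subgraph G (hypercube n)"
    and "connected_graph G"
  shows "rainbow_boomerang G \<longleftrightarrow>
    (\<forall>n' H. subhypercube n' n H \<longrightarrow> connected_graph (graph_inter G H))"
  using assms intersection_connected_if_rainbow_boomerang
    rainbow_boomerang_if_intersections_connected
  by blast

end
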